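(* Let $M$ be a two-sided invertible $n\times n$ $q$-Manin matrix over $\mathfrak R$ (i.e. there exists $M^{-1}$ with $M^{-1}M=MM^{-1}=1$). Then for $1\le i_1<i_2\le n$, $1\le j\le n$ and $1\le j_1<j_2\le n$, $$\det\nolimits_q M\,\big(M^{-1}_{i_1j}M^{-1}_{i_2j}-q\,M^{-1}_{i_2j}M^{-1}_{i_1j}\big)=0,$$ $$\det\nolimits_q M\,\big(M^{-1}_{i_1j_1}M^{-1}_{i_2j_2}-q\,M^{-1}_{i_2j_1}M^{-1}_{i_1j_2}\big)=(-q)^{j_1+j_2-i_1-i_2}\det\nolimits_q\big(M_{\backslash(j_1j_2)\backslash(i_1i_2)}\big),$$ $$\det\nolimits_q M\,\big(M^{-1}_{i_1j_2}M^{-1}_{i_2j_1}-q\,M^{-1}_{i_2j_2}M^{-1}_{i_1j_1}\big)=(-q)^{j_1+j_2-i_1-i_2+1}\det\nolimits_q\big(M_{\backslash(j_1j_2)\backslash(i_1i_2)}\big),$$ where $M^{-1}_{ij}$ are the entries of $M^{-1}$ and $M_{\backslash(j_1j_2)\backslash(i_1i_2)}$ is the $(n-2)\times(n-2)$ matrix obtained from $M$ by deleting rows $j_1,j_2$ and columns $i_1,i_2$.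
   Context: Let $q$ be a nonzero complex number and $\mathfrak R$ an associative unital, not necessarily commutative, algebra over $\mathbb C$. A matrix $M=(M_{ij})$ over $\mathfrak R$ is called $q$-Manin if $M_{ij}M_{kj}=q^{-1}M_{kj}M_{ij}$ for all $j$ and all $i<k$, and $M_{ij}M_{kl}-M_{kl}M_{ij}=q^{-1}M_{kj}M_{il}-q\,M_{il}M_{kj}$ for all $i<k$, $j<l$. The $q$-determinant of an $n\times n$ matrix is $\det_q M=\sum_{\tau\in\mathfrak S_n}(-q)^{-\mathrm{inv}(\tau)}M_{\tau(1)1}M_{\tau(2)2}\cdots M_{\tau(n)n}$, where $\mathrm{inv}(\tau)$ is the number of inversions of $\tau$ (and $\det_q$ of an empty matrix is $1$). *)

theory Defs
  imports
    Complex_Main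
    "HOL-Combinatorics.Permutations"
    "Jordan_Normal_Form.Matrix"
    "Jordan_Normal_Form.DL_Submatrix"
begin

text \<open>
  Associative unital, not necessarily commutative, algebras over the complex numbers, modelled on
  the class \<^class>\<open>real_algebra_1\<close>. In contrast to the latter, the zero algebra is
  admitted: the base classes do not include the axiom \<open>0 \<noteq> 1\<close>.
\<close>

class complex_algebra_1 = ring + monoid_mult +
  fixes scaleC :: "complex \<Rightarrow> 'a \<Rightarrow> 'a"  (infixr \<open>*\<^sub>C\<close> 75)
  assumes scaleC_add_right: "a *\<^sub>C (x + y) = a *\<^sub>C x + a *\<^sub>C y"
    and scaleC_add_left: "(a + b) *\<^sub>C x = a *\<^sub>C x + b *\<^sub>C x"
    and scaleC_scaleC: "a *\<^sub>C (b *\<^sub>C x) = (a * b) *\<^sub>C x"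
    and scaleC_one: "1 *\<^sub>C x = x"
    and mult_scaleC_left: "(a *\<^sub>C x) * y = a *\<^sub>C (x * y)"
    and mult_scaleC_right: "x * (a *\<^sub>C y) = a *\<^sub>C (x * y)"

text \<open>
  Rows and columns are numbered from \<open>0\<close>, as for all matrices of type
  \<^typ>\<open>'a mat\<close>. The matrix need not be square.
\<close>

definition q_manin :: "complex \<Rightarrow> 'a::complex_algebra_1 mat \<Rightarrow> bool" where
  "q_manin q M \<longleftrightarrow>
    (\<forall>i k j. i < k \<and> k < dim_row M \<and> j < dim_col M \<longrightarrow>
      M $$ (i,j) * M $$ (k,j) = inverse q *\<^sub>C (M $$ (k,j) * M $$ (i,j))) \<and>
    (\<forall>i k j l. i < k \<and> k < dim_row M \<and> j < l \<and> l < dim_col M \<longrightarrow>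
      M $$ (i,j) * M $$ (k,l) - M $$ (k,l) * M $$ (i,j) =
        inverse q *\<^sub>C (M $$ (k,j) * M $$ (i,l)) - q *\<^sub>C (M $$ (i,l) * M $$ (k,j)))"

definition inversions :: "nat \<Rightarrow> (nat \<Rightarrow> nat) \<Rightarrow> nat" where
  "inversions n \<tau> = card {(a, b). a < b \<and> b < n \<and> \<tau> b < \<tau> a}"

text \<open>
  The factors do not commute: they are multiplied from left to right in the order of the
  columns. The definition is meant for square matrices.
\<close>

definition q_det :: "complex \<Rightarrow> 'a::complex_algebra_1 mat \<Rightarrow> 'a" where
  "q_det q M =
    (\<Sum>\<tau> | \<tau> permutes {0..<dim_col M}.
      (- q) powi (- int (inversions (dim_col M) \<tau>)) *\<^sub>C
        prod_list (map (\<lambda>j. M $$ (\<tau> j, j)) [0..<dim_col M]))"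

end

theory Submission
  imports Defs
begin

text \<open>
  The proof takes place in the \<open>q\<close>-exterior algebra over the given ring: its generators
  \<open>\<psi>\<^sub>0, \<psi>\<^sub>1, \<dots>\<close> commute with the scalars and satisfy \<open>\<psi>\<^sub>i\<psi>\<^sub>i = 0\<close> and
  \<open>\<psi>\<^sub>k\<psi>\<^sub>i = c \<psi>\<^sub>i\<psi>\<^sub>k\<close> for \<open>i < k\<close>, where \<open>c = - inverse q\<close>. Put
  \<open>\<phi>\<^sub>j = \<Sum>\<^sub>i \<psi>\<^sub>i M\<^sub>i\<^sub>j\<close>. The \<open>q\<close>-Manin condition makes the
  \<open>\<phi>\<^sub>j\<close> satisfy the same relations (\<open>wedge_col_same\<close>, \<open>wedge_col_swap\<close>). The coefficients
  of a product of several \<open>\<phi>\<^sub>j\<close> are the \<open>q\<close>-minors of the columns involved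
  (\<open>fold_wedge_col_nths_eq_q_det_submatrix\<close>); in particular
  \<open>\<phi>\<^sub>0 \<cdots> \<phi>\<^sub>n\<^sub>-\<^sub>1 = \<psi>\<^sub>0 \<cdots> \<psi>\<^sub>n\<^sub>-\<^sub>1 det\<^sub>q M\<close>.

  Let \<open>N\<close> be the inverse of \<open>M\<close>, so that \<open>\<psi>\<^sub>a = \<Sum>\<^sub>k \<phi>\<^sub>k N\<^sub>k\<^sub>a\<close>, and let \<open>\<omega>\<close> be the
  ordered product of all \<open>\<phi>\<^sub>j\<close> except \<open>\<phi>\<close> at \<open>i\<^sub>1\<close> and \<open>i\<^sub>2\<close>. The coefficient of
  \<open>\<psi>\<^sub>0 \<cdots> \<psi>\<^sub>n\<^sub>-\<^sub>1\<close> in \<open>\<omega>\<psi>\<^sub>a\<psi>\<^sub>b\<close> is now computed in two ways.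
  Since \<open>\<psi>\<^sub>a\<close> commutes with the entries of \<open>N\<close>,
  \<open>\<omega>\<psi>\<^sub>a\<psi>\<^sub>b = \<Sum>\<^sub>k\<^sub>,\<^sub>l \<omega>\<phi>\<^sub>k\<phi>\<^sub>l N\<^sub>l\<^sub>b N\<^sub>k\<^sub>a\<close>, and only the two
  terms with \<open>{k, l} = {i\<^sub>1, i\<^sub>2}\<close> survive; reordering the \<open>\<phi>\<close>'s turns them into a
  power of \<open>c\<close> times \<open>det\<^sub>q M\<close> times the quadratic expression in the entries of \<open>N\<close>
  (\<open>wedge_wedge_two_removed\<close>). On the other hand, if \<open>a\<close> and \<open>b\<close> are distinct, the
  coefficient is a power of \<open>c\<close> times the coefficient of \<open>\<omega>\<close> at the complement of
  \<open>{a, b}\<close> (\<open>wedge_wedge_top\<close>), that is, times a \<open>q\<close>-minor of size \<open>n - 2\<close>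
  (\<open>fold_wedge_col_complement_minor\<close>); if
  \<open>a = b\<close>, it vanishes. The choices \<open>(a, b) = (j, j), (j\<^sub>2, j\<^sub>1), (j\<^sub>1, j\<^sub>2)\<close> give the three
  identities.
\<close>

section \<open>Complex scalars and double sums\<close>

lemma scaleC_zero_right: "a *\<^sub>C (0::'a::complex_algebra_1) = 0"
  using scaleC_add_right[of a 0 "0::'a"] by simp

lemma scaleC_zero_left: "0 *\<^sub>C (x::'a::complex_algebra_1) = 0"
  using scaleC_add_left[of 0 0 x] by simp

lemma scaleC_minus_right: "a *\<^sub>C (- x) = - (a *\<^sub>C (x::'a::complex_algebra_1))"
  using scaleC_add_right[of a x "- x"] by (simp add: scaleC_zero_right eq_neg_iff_add_eq_0 add.commute)

lemma scaleC_minus_left: "(- a) *\<^sub>C x = - (a *\<^sub>C (x::'a::complex_algebra_1))"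
  using scaleC_add_left[of a "- a" x] by (simp add: scaleC_zero_left eq_neg_iff_add_eq_0 add.commute)

lemma scaleC_diff_right: "a *\<^sub>C (x - y) = a *\<^sub>C x - a *\<^sub>C (y::'a::complex_algebra_1)"
  using scaleC_add_right[of a x "- y"] by (simp add: scaleC_minus_right)

lemma scaleC_sum_right: "a *\<^sub>C (\<Sum>i\<in>A. f i) = (\<Sum>i\<in>A. a *\<^sub>C (f i :: 'a::complex_algebra_1))"
  by (induction A rule: infinite_finite_induct) (auto simp: scaleC_zero_right scaleC_add_right)

lemma scaleC_left_cancel:
  assumes "a \<noteq> 0" "a *\<^sub>C x = a *\<^sub>C (y::'a::complex_algebra_1)"
  shows "x = y"
  using arg_cong[OF assms(2), of "\<lambda>z. inverse a *\<^sub>C z"] assms(1)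
  by (simp add: scaleC_scaleC scaleC_one)

lemma sum_off_diagonal_pairs:
  fixes f :: "nat \<Rightarrow> nat \<Rightarrow> 'a::comm_monoid_add"
  assumes "\<And>i. f i i = 0"
  shows "(\<Sum>i<n. \<Sum>k<n. f i k) = (\<Sum>k<n. \<Sum>i<k. f i k + f k i)"
  by (induction n) (simp_all add: sum.distrib assms ac_simps)

section \<open>The q-exterior algebra\<close>

text \<open>
  An element \<open>\<Sum>\<^sub>S \<psi>\<^sub>S \<omega>\<^sub>S\<close> of the \<open>q\<close>-exterior algebra, with \<open>\<psi>\<^sub>S\<close> the product of the
  \<open>\<psi>\<^sub>s\<close>, \<open>s \<in> S\<close>, in increasing order, is represented by its coefficient function
  \<open>S \<mapsto> \<omega>\<^sub>S\<close>. The function below is right multiplication by \<open>\<psi>\<^sub>i\<close>: to reach its place in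
  \<open>\<psi>\<^sub>T\<close>, the new factor passes the generators with larger index, each contributing a factor
  \<open>- inverse q\<close>. Only finite \<open>T\<close> index basis elements, and on infinite \<open>T\<close> the cardinality would
  not count anything; the value there is \<open>0\<close>.
\<close>

definition wedge :: "complex \<Rightarrow> nat \<Rightarrow> (nat set \<Rightarrow> 'a::complex_algebra_1) \<Rightarrow> nat set \<Rightarrow> 'a" where
  "wedge q i \<omega> = (\<lambda>T. if finite T \<and> i \<in> T
     then (- inverse q) ^ card {s\<in>T. i < s} *\<^sub>C \<omega> (T - {i}) else 0)"

text \<open>
  Right multiplication by \<open>\<phi>\<^sub>j = \<Sum>\<^sub>i \<psi>\<^sub>i M\<^sub>i\<^sub>j\<close>. As the \<open>\<psi>\<^sub>i\<close> commute with scalars, the entry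
  \<open>M\<^sub>i\<^sub>j\<close> ends up to the right of the coefficient. The element \<open>\<omega>\<phi>\<^sub>j\<phi>\<^sub>l\<close> is thus
  \<open>wedge_col q M l (wedge_col q M j \<omega>)\<close>, and multiplying by the \<open>\<phi>\<^sub>j\<close> along a list, read from
  left to right, is \<open>fold (wedge_col q M)\<close>.
\<close>

definition wedge_col ::
    "complex \<Rightarrow> 'a::complex_algebra_1 mat \<Rightarrow> nat \<Rightarrow> (nat set \<Rightarrow> 'a) \<Rightarrow> nat set \<Rightarrow> 'a" where
  "wedge_col q M j \<omega> = (\<lambda>T. \<Sum>i<dim_row M. wedge q i \<omega> T * M $$ (i,j))"

lemma wedge_scaleC: "wedge q i (\<lambda>S. a *\<^sub>C \<omega> S) = (\<lambda>T. a *\<^sub>C wedge q i \<omega> T)"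
  by (rule ext) (simp add: wedge_def scaleC_scaleC scaleC_zero_right mult.commute)

lemma wedge_sum_mult:
  "wedge q i (\<lambda>S. \<Sum>k\<in>A. \<omega> k S * x k) = (\<lambda>T. \<Sum>k\<in>A. wedge q i (\<omega> k) T * x k)"
proof
  fix T
  show "wedge q i (\<lambda>S. \<Sum>k\<in>A. \<omega> k S * x k) T = (\<Sum>k\<in>A. wedge q i (\<omega> k) T * x k)"
    by (cases "finite T \<and> i \<in> T") (auto simp: wedge_def scaleC_sum_right mult_scaleC_left)
qed

lemma wedge_col_scaleC:
  "wedge_col q M j (\<lambda>S. a *\<^sub>C \<omega> S) = (\<lambda>T. a *\<^sub>C wedge_col q M j \<omega> T)"
  by (rule ext) (simp add: wedge_col_def wedge_scaleC scaleC_sum_right mult_scaleC_left)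

lemma wedge_col_zero: "wedge_col q M j (\<lambda>S. 0) = (\<lambda>T. 0)"
  by (rule ext) (simp add: wedge_col_def wedge_def scaleC_zero_right cong: if_cong)

lemma wedge_wedge_same: "wedge q i (wedge q i \<omega>) T = 0"
  by (simp add: wedge_def scaleC_zero_right)

text \<open>
  If \<open>\<psi>\<^sub>i\<close> is multiplied last, it has to pass \<open>\<psi>\<^sub>k\<close> as well, which gives one more factor
  \<open>- inverse q\<close> than the opposite order.
\<close>

lemma wedge_wedge_swap:
  assumes "i < k"
  shows "wedge q i (wedge q k \<omega>) T = - inverse q *\<^sub>C wedge q k (wedge q i \<omega>) T"
proof (cases "finite T \<and> i \<in> T \<and> k \<in> T")
  case True
  have "{s\<in>T - {i}. k < s} = {s\<in>T. k < s}" using assms by auto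
  moreover have "{s\<in>T. i < s} = insert k {s\<in>T - {k}. i < s}" using assms True by auto
  then have "card {s\<in>T. i < s} = Suc (card {s\<in>T - {k}. i < s})" using True by simp
  moreover have "T - {i} - {k} = T - {k} - {i}" by auto
  ultimately show ?thesis
    using True assms by (simp add: wedge_def scaleC_scaleC mult_ac)
next
  case False
  then show ?thesis by (auto simp: wedge_def scaleC_zero_right)
qed

section \<open>The columns of a q-Manin matrix satisfy the exterior relations\<close>

lemma wedge_col_wedge_col:
  "wedge_col q M l (wedge_col q M j \<omega>) T =
    (\<Sum>i<dim_row M. \<Sum>k<dim_row M. wedge q k (wedge q i \<omega>) T * (M $$ (i,j) * M $$ (k,l)))"
proof -
  have "wedge_col q M l (wedge_col q M j \<omega>) T =
    (\<Sum>k<dim_row M. \<Sum>i<dim_row M. wedge q k (wedge q i \<omega>) T * (M $$ (i,j) * M $$ (k,l)))"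
    unfolding wedge_col_def wedge_sum_mult by (simp add: sum_distrib_right mult.assoc)
  also note sum.swap
  finally show ?thesis .
qed

text \<open>
  Collecting the terms for \<open>\<psi>\<^sub>i\<psi>\<^sub>k\<close> and \<open>\<psi>\<^sub>k\<psi>\<^sub>i\<close> with \<open>i < k\<close> exhibits the coefficients of
  \<open>\<phi>\<^sub>j\<phi>\<^sub>l\<close> as the \<open>q\<close>-minors of size two. Both exterior relations for the \<open>\<phi>\<^sub>j\<close> thereby become
  statements about these minors, one for each half of the Manin condition.
\<close>

lemma wedge_col_wedge_col_ordered:
  "wedge_col q M l (wedge_col q M j \<omega>) T =
    (\<Sum>k<dim_row M. \<Sum>i<k. wedge q k (wedge q i \<omega>) T *
      (M $$ (i,j) * M $$ (k,l) - inverse q *\<^sub>C (M $$ (k,j) * M $$ (i,l))))"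
  unfolding wedge_col_wedge_col
  by (subst sum_off_diagonal_pairs)
    (auto intro!: sum.cong simp: wedge_wedge_same wedge_wedge_swap right_diff_distrib mult_scaleC_left mult_scaleC_right
       scaleC_minus_left)

lemma wedge_col_same:
  assumes "q_manin q M" "j < dim_col M"
  shows "wedge_col q M j (wedge_col q M j \<omega>) = (\<lambda>T. 0)"
proof
  fix T
  have "M $$ (i,j) * M $$ (k,j) - inverse q *\<^sub>C (M $$ (k,j) * M $$ (i,j)) = 0"
    if "i < k" "k < dim_row M" for i k
    using assms that by (simp add: q_manin_def)
  then show "wedge_col q M j (wedge_col q M j \<omega>) T = 0"
    unfolding wedge_col_wedge_col_ordered by (intro sum.neutral ballI) simp
qed

lemma wedge_col_swap:
  assumes "q \<noteq> 0" "q_manin q M" "j < l" "l < dim_col M"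
  shows "wedge_col q M j (wedge_col q M l \<omega>) = (\<lambda>T. - inverse q *\<^sub>C wedge_col q M l (wedge_col q M j \<omega>) T)"
proof
  fix T
  have minor: "M $$ (i,l) * M $$ (k,j) - inverse q *\<^sub>C (M $$ (k,l) * M $$ (i,j)) =
      - inverse q *\<^sub>C (M $$ (i,j) * M $$ (k,l) - inverse q *\<^sub>C (M $$ (k,j) * M $$ (i,l)))"
    if "i < k" "k < dim_row M" for i k
  proof -
    have "M $$ (i,j) * M $$ (k,l) - M $$ (k,l) * M $$ (i,j) =
        inverse q *\<^sub>C (M $$ (k,j) * M $$ (i,l)) - q *\<^sub>C (M $$ (i,l) * M $$ (k,j))"
      using assms that unfolding q_manin_def by blast
    (* The commutation relation, rewritten so that each side is a multiple of a minor. *)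
    then have "M $$ (i,j) * M $$ (k,l) - inverse q *\<^sub>C (M $$ (k,j) * M $$ (i,l)) =
        M $$ (k,l) * M $$ (i,j) - q *\<^sub>C (M $$ (i,l) * M $$ (k,j))"
      by (simp add: algebra_simps)
    then show ?thesis
      using assms(1) by (simp add: scaleC_diff_right scaleC_minus_left scaleC_scaleC scaleC_one)
  qed
  show "wedge_col q M j (wedge_col q M l \<omega>) T = - inverse q *\<^sub>C wedge_col q M l (wedge_col q M j \<omega>) T"
    unfolding wedge_col_wedge_col_ordered scaleC_sum_right
    by (intro sum.cong refl) (simp only: minor lessThan_iff mult_scaleC_right)
qed

text \<open>
  The new factor \<open>\<phi>\<^sub>k\<close> is moved to the left, past the \<open>\<phi>\<^sub>m\<close> with \<open>m \<noteq> k\<close>, until it meets its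
  earlier occurrence. Moving it past a smaller \<open>m\<close> uses the commutation relation in the direction
  that requires dividing by \<open>- inverse q\<close>, hence \<open>q \<noteq> 0\<close>.
\<close>

lemma fold_wedge_col_repeated:
  assumes "q \<noteq> 0" "q_manin q M" "k \<in> set js" "\<forall>j\<in>set js. j < dim_col M"
  shows "wedge_col q M k (fold (wedge_col q M) js \<omega>) = (\<lambda>T. 0)"
  using assms(3,4)
proof (induction js rule: rev_induct)
  case (snoc m js)
  show ?case
  proof (cases "m = k")
    case True
    then show ?thesis using wedge_col_same[OF assms(2)] snoc.prems by simp
  next
    case False
    define \<eta> where "\<eta> = fold (wedge_col q M) js \<omega>"
    have IH: "wedge_col q M k \<eta> = (\<lambda>T. 0)" using snoc False by (simp add: \<eta>_def)
    have "wedge_col q M k (wedge_col q M m \<eta>) = (\<lambda>T. 0)"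
    proof (cases "k < m")
      case True
      then show ?thesis
        using wedge_col_swap[OF assms(1,2) True, of \<eta>] snoc.prems
        by (simp add: IH wedge_col_zero scaleC_zero_right)
    next
      case False
      then have "m < k" using \<open>m \<noteq> k\<close> by simp
      moreover have "k < dim_col M" using snoc.prems by auto
      ultimately have "(\<lambda>T. - inverse q *\<^sub>C wedge_col q M k (wedge_col q M m \<eta>) T) = (\<lambda>T. - inverse q *\<^sub>C 0)"
        using wedge_col_swap[OF assms(1,2), of m k \<eta>] by (simp add: IH wedge_col_zero scaleC_zero_right)
      then show ?thesis
        using assms(1) scaleC_left_cancel[of "- inverse q"] by (auto simp: fun_eq_iff)
    qed
    then show ?thesis by (simp add: \<eta>_def)
  qed
qed simp

lemma wedge_col_fold_larger:
  assumes "q \<noteq> 0" "q_manin q M" "\<forall>j\<in>set js. i < j \<and> j < dim_col M"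
  shows "wedge_col q M i (fold (wedge_col q M) js \<omega>) =
    (\<lambda>T. (- inverse q) ^ length js *\<^sub>C fold (wedge_col q M) js (wedge_col q M i \<omega>) T)"
  using assms(3)
proof (induction js rule: rev_induct)
  case Nil
  show ?case by (simp add: scaleC_one)
next
  case (snoc m js)
  then show ?case
    by (simp add: wedge_col_swap[OF assms(1,2)] wedge_col_scaleC scaleC_scaleC)
qed

text \<open>
  This is \<open>\<psi>\<^sub>j = \<Sum>\<^sub>k \<phi>\<^sub>k N\<^sub>k\<^sub>j\<close>, through which the entries of the inverse enter the argument.
\<close>

lemma wedge_eq_sum_wedge_col:
  assumes M: "M \<in> carrier_mat n n" and N: "N \<in> carrier_mat n n" and MN: "M * N = 1\<^sub>m n" and "j < n"
  shows "wedge q j \<omega> = (\<lambda>T. \<Sum>k<n. wedge_col q M k \<omega> T * N $$ (k,j))"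
proof
  fix T
  have entry: "(\<Sum>k<n. M $$ (i,k) * N $$ (k,j)) = (if i = j then 1 else 0)" if "i < n" for i
  proof -
    have "(M * N) $$ (i,j) = (\<Sum>k<n. M $$ (i,k) * N $$ (k,j))"
      using M N that \<open>j < n\<close> by (simp add: scalar_prod_def atLeast0LessThan)
    then show ?thesis using MN that \<open>j < n\<close> by simp
  qed
  have "(\<Sum>k<n. wedge_col q M k \<omega> T * N $$ (k,j)) =
      (\<Sum>k<n. \<Sum>i<n. wedge q i \<omega> T * (M $$ (i,k) * N $$ (k,j)))"
    using M by (simp add: wedge_col_def sum_distrib_right mult.assoc)
  also have "\<dots> = (\<Sum>i<n. \<Sum>k<n. wedge q i \<omega> T * (M $$ (i,k) * N $$ (k,j)))"
    by (rule sum.swap)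
  also have "\<dots> = (\<Sum>i<n. if i = j then wedge q i \<omega> T else 0)"
    by (intro sum.cong refl) (simp add: sum_distrib_left[symmetric] entry)
  also have "\<dots> = wedge q j \<omega> T" using \<open>j < n\<close> by simp
  finally show "wedge q j \<omega> T = (\<Sum>k<n. wedge_col q M k \<omega> T * N $$ (k,j))" ..
qed

section \<open>Minors as coefficients of products of columns\<close>

definition unit_form :: "nat set \<Rightarrow> 'a::complex_algebra_1" where
  "unit_form S = (if S = {} then 1 else 0)"

text \<open>
  Words of row indices are more convenient for an induction on the number of columns than
  permutations: the last letter can be split off without renumbering the others.
\<close>

definition word_inversions :: "nat list \<Rightarrow> nat" where
  "word_inversions w = inversions (length w) (\<lambda>a. w ! a)"

lemma finite_inversions: "finite {(a, b). a < b \<and> b < n \<and> \<tau> b < (\<tau> a :: nat)}" for n :: nat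
  by (rule finite_subset[of _ "{..<n} \<times> {..<n}"]) auto

text \<open>
  The inversions that involve the last position are those with a larger letter before it. Their
  number is exactly the exponent in the definition of \<open>wedge\<close>.
\<close>

lemma word_inversions_snoc:
  assumes "distinct w"
  shows "word_inversions (w @ [i]) = word_inversions w + card {s\<in>set w. i < s}"
proof -
  let ?old = "{(a, b). a < b \<and> b < length w \<and> w ! b < w ! a}"
  let ?new = "(\<lambda>a. (a, length w)) ` {a. a < length w \<and> i < w ! a}"
  have eq: "{(a, b). a < b \<and> b < length (w @ [i]) \<and> (w @ [i]) ! b < (w @ [i]) ! a} = ?old \<union> ?new"
    by (auto simp: nth_append less_Suc_eq split: if_splits)
  have "card ?new = card {a. a < length w \<and> i < w ! a}"
    by (rule card_image) (simp add: inj_on_def)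
  also have "\<dots> = card ((\<lambda>a. w ! a) ` {a. a < length w \<and> i < w ! a})"
    by (rule card_image[symmetric]) (use assms in \<open>auto simp: inj_on_def nth_eq_iff_index_eq\<close>)
  also have "(\<lambda>a. w ! a) ` {a. a < length w \<and> i < w ! a} = {s\<in>set w. i < s}"
    by (auto simp: in_set_conv_nth)
  finally have new: "card ?new = card {s\<in>set w. i < s}" .
  have "card (?old \<union> ?new) = card ?old + card ?new"
    by (rule card_Un_disjoint) (auto intro: finite_inversions)
  then show ?thesis unfolding word_inversions_def inversions_def eq new by simp
qed

text \<open>
  Multiplying out a product of \<open>\<phi>\<^sub>j\<close>'s gives one term for every word of row indices. Words with a
  repeated letter die, and the others are sorted at the cost of one factor \<open>- inverse q\<close> for each
  inversion. The induction splits off the last letter \<open>i\<close> of the word, which is the row chosen in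
  the last column.
\<close>

lemma fold_wedge_col_unit:
  assumes "finite S" "\<forall>i\<in>S. i < dim_row M"
  shows "fold (wedge_col q M) js unit_form S =
    (\<Sum>w | distinct w \<and> set w = S \<and> length w = length js.
      (- inverse q) ^ word_inversions w *\<^sub>C
        prod_list (map (\<lambda>b. M $$ (w ! b, js ! b)) [0..<length js]))"
  using assms
proof (induction js arbitrary: S rule: rev_induct)
  case Nil
  have "{w. distinct w \<and> set w = S \<and> length w = 0} = (if S = {} then {[]} else {})" by auto
  then show ?case by (simp add: unit_form_def word_inversions_def inversions_def scaleC_one)
next
  case (snoc j js)
  let ?c = "- inverse q"
  let ?W = "\<lambda>i. {w. distinct w \<and> set w = S - {i} \<and> length w = length js}"
  let ?P = "\<lambda>w. prod_list (map (\<lambda>b. M $$ (w ! b, js ! b)) [0..<length js])"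
  let ?P' = "\<lambda>w. prod_list (map (\<lambda>b. M $$ (w ! b, (js @ [j]) ! b)) [0..<length (js @ [j])])"
  have fin: "finite (?W i)" for i
    by (rule finite_subset[OF _ finite_lists_length_eq[of "S - {i}" "length js"]])
      (use snoc.prems in auto)
  have set_eq: "{w. distinct w \<and> set w = S \<and> length w = length (js @ [j])} =
      (\<lambda>(i, w). w @ [i]) ` (SIGMA i:S. ?W i)"
  proof (intro equalityI subsetI)
    fix v assume v: "v \<in> {w. distinct w \<and> set w = S \<and> length w = length (js @ [j])}"
    then have "v \<noteq> []" by auto
    then obtain w i where vw: "v = w @ [i]" by (metis append_butlast_last_id)
    have "(i, w) \<in> (SIGMA i:S. ?W i)" using v unfolding vw by auto
    then show "v \<in> (\<lambda>(i, w). w @ [i]) ` (SIGMA i:S. ?W i)"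
      unfolding vw by (rule rev_image_eqI) simp
  next
    fix v assume "v \<in> (\<lambda>(i, w). w @ [i]) ` (SIGMA i:S. ?W i)"
    then obtain i w where "v = w @ [i]" "i \<in> S" "w \<in> ?W i" by (auto simp only: image_iff mem_Sigma_iff split: prod.splits)
    then show "v \<in> {w. distinct w \<and> set w = S \<and> length w = length (js @ [j])}" by auto
  qed
  have inj: "inj_on (\<lambda>(i, w). w @ [i]) (SIGMA i:S. ?W i)" by (auto simp: inj_on_def)
  have term_eq: "?c ^ word_inversions (w @ [i]) *\<^sub>C ?P' (w @ [i]) =
      ?c ^ card {s\<in>S. i < s} *\<^sub>C (?c ^ word_inversions w *\<^sub>C ?P w) * M $$ (i,j)"
    if "i \<in> S" "w \<in> ?W i" for i w
  proof -
    have "{s\<in>set w. i < s} = {s\<in>S. i < s}" using that by auto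
    then have inv: "word_inversions (w @ [i]) = word_inversions w + card {s\<in>S. i < s}"
      using that by (simp add: word_inversions_snoc)
    have init: "map (\<lambda>b. M $$ ((w @ [i]) ! b, (js @ [j]) ! b)) [0..<length js] =
        map (\<lambda>b. M $$ (w ! b, js ! b)) [0..<length js]"
      using that by (simp add: nth_append)
    have final: "(w @ [i]) ! length js = i" using that by (simp add: nth_append)
    have "?P' (w @ [i]) = prod_list (map (\<lambda>b. M $$ ((w @ [i]) ! b, (js @ [j]) ! b)) [0..<length js]) *
        M $$ ((w @ [i]) ! length js, j)"
      by simp
    also have "\<dots> = ?P w * M $$ (i,j)" by (simp only: init final)
    finally show ?thesis
      unfolding inv by (simp add: mult_scaleC_left scaleC_scaleC power_add mult.commute)
  qed
  have "fold (wedge_col q M) (js @ [j]) unit_form S =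
      (\<Sum>i<dim_row M. wedge q i (fold (wedge_col q M) js unit_form) S * M $$ (i,j))"
    by (simp add: wedge_col_def)
  also have "\<dots> = (\<Sum>i\<in>S. wedge q i (fold (wedge_col q M) js unit_form) S * M $$ (i,j))"
    using snoc.prems by (intro sum.mono_neutral_right) (auto simp: wedge_def)
  also have "\<dots> = (\<Sum>i\<in>S. \<Sum>w\<in>?W i. ?c ^ word_inversions (w @ [i]) *\<^sub>C ?P' (w @ [i]))"
  proof (rule sum.cong[OF refl])
    fix i assume "i \<in> S"
    then have "wedge q i (fold (wedge_col q M) js unit_form) S * M $$ (i,j) =
      ?c ^ card {s\<in>S. i < s} *\<^sub>C (\<Sum>w\<in>?W i. ?c ^ word_inversions w *\<^sub>C ?P w) * M $$ (i,j)"
      using snoc.prems by (simp add: wedge_def snoc.IH)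
    also have "\<dots> = (\<Sum>w\<in>?W i. ?c ^ word_inversions (w @ [i]) *\<^sub>C ?P' (w @ [i]))"
      unfolding scaleC_sum_right sum_distrib_right
      by (rule sum.cong[OF refl]) (rule term_eq[symmetric, OF \<open>i \<in> S\<close>])
    finally show "wedge q i (fold (wedge_col q M) js unit_form) S * M $$ (i,j) =
      (\<Sum>w\<in>?W i. ?c ^ word_inversions (w @ [i]) *\<^sub>C ?P' (w @ [i]))" .
  qed
  also have "\<dots> = (\<Sum>(i, w)\<in>(SIGMA i:S. ?W i). ?c ^ word_inversions (w @ [i]) *\<^sub>C ?P' (w @ [i]))"
    using snoc.prems fin by (intro sum.Sigma) auto
  also have "\<dots> = (\<Sum>w\<in>(\<lambda>(i, w). w @ [i]) ` (SIGMA i:S. ?W i). ?c ^ word_inversions w *\<^sub>C ?P' w)"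
    by (subst sum.reindex[OF inj]) (simp add: case_prod_beta comp_def)
  finally show ?case unfolding set_eq .
qed

text \<open>
  This translates the words above into the permutations that index the sum defining \<open>q_det\<close>.
\<close>

lemma bij_betw_permutes_arrangements:
  fixes rs :: "nat list"
  assumes "distinct rs"
  shows "bij_betw (\<lambda>\<tau>. map (\<lambda>a. rs ! \<tau> a) [0..<length rs]) {\<tau>. \<tau> permutes {0..<length rs}}
    {w. distinct w \<and> set w = set rs \<and> length w = length rs}"
proof (rule bij_betwI')
  fix \<tau> \<sigma> assume p: "\<tau> \<in> {\<tau>. \<tau> permutes {0..<length rs}}" "\<sigma> \<in> {\<tau>. \<tau> permutes {0..<length rs}}"
  have "\<tau> = \<sigma>" if eq: "map (\<lambda>a. rs ! \<tau> a) [0..<length rs] = map (\<lambda>a. rs ! \<sigma> a) [0..<length rs]"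
  proof
    fix a
    show "\<tau> a = \<sigma> a"
    proof (cases "a < length rs")
      case True
      then have "rs ! \<tau> a = rs ! \<sigma> a" using eq by auto
      moreover have "\<tau> a < length rs" "\<sigma> a < length rs"
        using p True permutes_in_image[of _ "{0..<length rs}" a] by auto
      ultimately show ?thesis using assms by (simp add: nth_eq_iff_index_eq)
    next
      case False
      then show ?thesis
        using p permutes_not_in[of \<tau> "{0..<length rs}" a] permutes_not_in[of \<sigma> "{0..<length rs}" a] by auto
    qed
  qed
  then show "(map (\<lambda>a. rs ! \<tau> a) [0..<length rs] = map (\<lambda>a. rs ! \<sigma> a) [0..<length rs]) = (\<tau> = \<sigma>)"
    by auto
next
  fix \<tau> assume "\<tau> \<in> {\<tau>. \<tau> permutes {0..<length rs}}"
  then have p: "\<tau> permutes {0..<length rs}" by simp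
  have "map (\<lambda>a. rs ! \<tau> a) [0..<length rs] = permute_list \<tau> rs" by (simp add: permute_list_def)
  then show "map (\<lambda>a. rs ! \<tau> a) [0..<length rs] \<in> {w. distinct w \<and> set w = set rs \<and> length w = length rs}"
    using p assms by (simp add: atLeast0LessThan)
next
  fix w assume w: "w \<in> {w. distinct w \<and> set w = set rs \<and> length w = length rs}"
  then have "mset w = mset rs" using assms set_eq_iff_mset_eq_distinct by blast
  then obtain \<tau> where "\<tau> permutes {..<length rs}" "permute_list \<tau> rs = w"
    by (rule mset_eq_permutation)
  then show "\<exists>\<tau>\<in>{\<tau>. \<tau> permutes {0..<length rs}}. w = map (\<lambda>a. rs ! \<tau> a) [0..<length rs]"
    by (auto simp: permute_list_def atLeast0LessThan)
qed

text \<open>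
  Because \<open>rs\<close> is increasing, the inversions of the word \<open>rs ! \<tau> 0, rs ! \<tau> 1, \<dots>\<close> are those of
  the permutation \<open>\<tau>\<close>.
\<close>

lemma fold_wedge_col_unit_eq_q_det:
  assumes rs: "sorted_wrt (<) rs" "\<forall>i\<in>set rs. i < dim_row M" and len: "length js = length rs"
  shows "fold (wedge_col q M) js unit_form (set rs) =
    q_det q (mat (length rs) (length rs) (\<lambda>(a, b). M $$ (rs ! a, js ! b)))"
proof -
  let ?r = "length rs"
  let ?A = "mat ?r ?r (\<lambda>(a, b). M $$ (rs ! a, js ! b))"
  let ?w = "\<lambda>\<tau>. map (\<lambda>a. rs ! \<tau> a) [0..<?r]"
  let ?f = "\<lambda>w. (- inverse q) ^ word_inversions w *\<^sub>C prod_list (map (\<lambda>b. M $$ (w ! b, js ! b)) [0..<?r])"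
  have dist: "distinct rs" using rs(1) by (simp add: strict_sorted_iff)
  have "fold (wedge_col q M) js unit_form (set rs) =
      (\<Sum>w | distinct w \<and> set w = set rs \<and> length w = ?r. ?f w)"
    using fold_wedge_col_unit[of "set rs" M q js] rs(2) len by simp
  also have "\<dots> = (\<Sum>\<tau> | \<tau> permutes {0..<?r}. ?f (?w \<tau>))"
    by (rule sum.reindex_bij_betw[OF bij_betw_permutes_arrangements[OF dist], symmetric])
  also have "\<dots> = q_det q ?A"
    unfolding q_det_def dim_col_mat
  proof (rule sum.cong[OF refl])
    fix \<tau> assume "\<tau> \<in> {\<tau>. \<tau> permutes {0..<?r}}"
    then have p: "\<tau> a < ?r" if "a < ?r" for a
      using that permutes_in_image[of \<tau> "{0..<?r}" a] by auto
    have less: "rs ! a < rs ! b \<longleftrightarrow> a < b" if "a < ?r" "b < ?r" for a b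
      using rs(1) that by (metis linorder_neqE_nat not_less_iff_gr_or_eq sorted_wrt_iff_nth_less)
    have "{(a, b). a < b \<and> b < ?r \<and> ?w \<tau> ! b < ?w \<tau> ! a} = {(a, b). a < b \<and> b < ?r \<and> \<tau> b < \<tau> a}"
      using p less by auto
    then have "word_inversions (?w \<tau>) = inversions ?r \<tau>"
      by (simp add: word_inversions_def inversions_def)
    moreover have "(- q) powi (- int m) = (- inverse q) ^ m" for m
      by (simp add: power_int_minus power_inverse[symmetric])
    moreover have "map (\<lambda>b. M $$ (?w \<tau> ! b, js ! b)) [0..<?r] = map (\<lambda>b. ?A $$ (\<tau> b, b)) [0..<?r]"
      using p by simp
    ultimately show "?f (?w \<tau>) = (- q) powi (- int (inversions ?r \<tau>)) *\<^sub>C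
        prod_list (map (\<lambda>b. ?A $$ (\<tau> b, b)) [0..<?r])"
      by metis
  qed
  finally show ?thesis .
qed

lemma nths_upt_eq_filter: "nths [0..<n] I = filter (\<lambda>i. i \<in> I) [0..<n]"
  by (induction n) (simp_all add: nths_append)

lemma set_nths_upt: "set (nths [0..<n] I) = {i. i < n \<and> i \<in> I}"
  by (auto simp: nths_upt_eq_filter)

lemma strict_sorted_nths_upt: "sorted_wrt (<) (nths [0..<n] I)"
  by (simp add: strict_sorted_iff sorted_nths)

lemma nths_upt_nth: "a < card {i. i < n \<and> i \<in> I} \<Longrightarrow> nths [0..<n] I ! a = pick I a"
  using nth_nths[of a "[0..<n]" I] pick_le[of a n I] by simp

lemma fold_wedge_col_nths_eq_q_det_submatrix:
  assumes "card {i. i < dim_row M \<and> i \<in> I} = card {j. j < dim_col M \<and> j \<in> J}"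
  shows "fold (wedge_col q M) (nths [0..<dim_col M] J) unit_form {i. i < dim_row M \<and> i \<in> I} =
    q_det q (submatrix M I J)"
proof -
  have "submatrix M I J = mat (length (nths [0..<dim_row M] I)) (length (nths [0..<dim_row M] I))
      (\<lambda>(a, b). M $$ (nths [0..<dim_row M] I ! a, nths [0..<dim_col M] J ! b))"
    by (rule eq_matI) (simp_all add: submatrix_def length_nths nths_upt_nth assms)
  then show ?thesis
    using fold_wedge_col_unit_eq_q_det[OF strict_sorted_nths_upt, of "dim_row M" I M "nths [0..<dim_col M] J" q] assms
    by (simp add: set_nths_upt length_nths)
qed

lemma fold_wedge_col_all_eq_q_det:
  assumes "M \<in> carrier_mat n n"
  shows "fold (wedge_col q M) [0..<n] unit_form {0..<n} = q_det q M"
proof -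
  have "submatrix M UNIV UNIV = M"
    by (rule eq_matI) (simp_all add: submatrix_def pick_UNIV)
  then show ?thesis
    using fold_wedge_col_nths_eq_q_det_submatrix[of M UNIV UNIV q] assms
    by (simp add: nths_all atLeast0LessThan lessThan_def)
qed

section \<open>Two columns removed and two generators appended\<close>

text \<open>
  The appended \<open>\<phi>\<close> of index \<open>i\<^sub>1\<close> passes all columns of larger index except the missing \<open>i\<^sub>2\<close>,
  which are \<open>n - 2 - i\<^sub>1\<close> many; after that the \<open>\<phi>\<close> of index \<open>i\<^sub>2\<close> passes the \<open>n - 1 - i\<^sub>2\<close> columns
  to the right of its place.
\<close>

lemma fold_wedge_col_two_removed:
  assumes "q \<noteq> 0" "M \<in> carrier_mat n n" "q_manin q M" "i\<^sub>1 < i\<^sub>2" "i\<^sub>2 < n"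
  shows "wedge_col q M i\<^sub>2 (wedge_col q M i\<^sub>1 (fold (wedge_col q M) (nths [0..<n] (- {i\<^sub>1, i\<^sub>2})) \<omega>)) T =
    (- inverse q) ^ (n - 2 - i\<^sub>1 + (n - 1 - i\<^sub>2)) *\<^sub>C fold (wedge_col q M) [0..<n] \<omega> T"
proof -
  let ?\<Phi> = "fold (wedge_col q M)"
  have upt: "[0..<n] = [0..<i\<^sub>1] @ i\<^sub>1 # [Suc i\<^sub>1..<i\<^sub>2] @ i\<^sub>2 # [Suc i\<^sub>2..<n]"
  proof -
    have "[0..<n] = [0..<i\<^sub>1] @ [i\<^sub>1..<n]"
      using assms(4,5) upt_add_eq_append[of 0 i\<^sub>1 "n - i\<^sub>1"] by simp
    moreover have "[i\<^sub>1..<n] = i\<^sub>1 # [Suc i\<^sub>1..<n]" "[i\<^sub>2..<n] = i\<^sub>2 # [Suc i\<^sub>2..<n]"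
      using assms(4,5) by (simp_all add: upt_conv_Cons)
    moreover have "[Suc i\<^sub>1..<n] = [Suc i\<^sub>1..<i\<^sub>2] @ [i\<^sub>2..<n]"
      using assms(4,5) upt_add_eq_append[of "Suc i\<^sub>1" i\<^sub>2 "n - i\<^sub>2"] by simp
    ultimately show ?thesis by metis
  qed
  have "nths [0..<n] (- {i\<^sub>1, i\<^sub>2}) = filter (\<lambda>i. i \<noteq> i\<^sub>1 \<and> i \<noteq> i\<^sub>2) [0..<n]"
    by (simp add: nths_upt_eq_filter)
  also have "\<dots> = [0..<i\<^sub>1] @ [Suc i\<^sub>1..<i\<^sub>2] @ [Suc i\<^sub>2..<n]"
    unfolding upt using assms(4) by (auto simp: filter_id_conv)
  finally have split: "nths [0..<n] (- {i\<^sub>1, i\<^sub>2}) = [0..<i\<^sub>1] @ [Suc i\<^sub>1..<i\<^sub>2] @ [Suc i\<^sub>2..<n]" .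
  define \<eta> where "\<eta> = ?\<Phi> [0..<i\<^sub>1] \<omega>"
  define \<theta> where "\<theta> = ?\<Phi> [Suc i\<^sub>1..<i\<^sub>2] (wedge_col q M i\<^sub>1 \<eta>)"
  have "wedge_col q M i\<^sub>1 (?\<Phi> ([Suc i\<^sub>1..<i\<^sub>2] @ [Suc i\<^sub>2..<n]) \<eta>) =
      (\<lambda>T. (- inverse q) ^ (n - 2 - i\<^sub>1) *\<^sub>C ?\<Phi> [Suc i\<^sub>2..<n] \<theta> T)"
    by (subst wedge_col_fold_larger[OF assms(1,3)]) (use assms in \<open>auto simp: \<theta>_def\<close>)
  moreover have "wedge_col q M i\<^sub>2 (?\<Phi> [Suc i\<^sub>2..<n] \<theta>) =
      (\<lambda>T. (- inverse q) ^ (n - 1 - i\<^sub>2) *\<^sub>C ?\<Phi> [Suc i\<^sub>2..<n] (wedge_col q M i\<^sub>2 \<theta>) T)"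
    by (subst wedge_col_fold_larger[OF assms(1,3)]) (use assms in auto)
  moreover have "?\<Phi> [0..<n] \<omega> = ?\<Phi> [Suc i\<^sub>2..<n] (wedge_col q M i\<^sub>2 \<theta>)"
    unfolding upt by (simp add: \<eta>_def \<theta>_def)
  ultimately show ?thesis
    unfolding split by (simp add: \<eta>_def wedge_col_scaleC scaleC_scaleC power_add)
qed

text \<open>
  Both appended generators are expanded in the \<open>\<phi>\<^sub>k\<close>. All products \<open>\<omega>\<phi>\<^sub>k\<phi>\<^sub>l\<close> with a repeated
  factor vanish, and the two remaining ones are proportional by the relation between the
  two appended columns. The exponent is the one of \<open>fold_wedge_col_two_removed\<close> plus one: the
  bracket arises with a factor \<open>- inverse q\<close> when it is normalised to begin with the product
  \<open>N $$ (i\<^sub>1,b) * N $$ (i\<^sub>2,a)\<close>.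
\<close>

lemma wedge_wedge_two_removed:
  assumes "q \<noteq> 0" "M \<in> carrier_mat n n" "q_manin q M" "N \<in> carrier_mat n n" "M * N = 1\<^sub>m n"
    and "i\<^sub>1 < i\<^sub>2" "i\<^sub>2 < n" "a < n" "b < n"
  shows "wedge q b (wedge q a (fold (wedge_col q M) (nths [0..<n] (- {i\<^sub>1, i\<^sub>2})) unit_form)) {0..<n} =
    (- inverse q) ^ (2 * n - 2 - i\<^sub>1 - i\<^sub>2) *\<^sub>C
      (q_det q M * (N $$ (i\<^sub>1,b) * N $$ (i\<^sub>2,a) - q *\<^sub>C (N $$ (i\<^sub>2,b) * N $$ (i\<^sub>1,a))))"
proof -
  let ?c = "- inverse q"
  let ?js = "nths [0..<n] (- {i\<^sub>1, i\<^sub>2})"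
  define \<omega> where "\<omega> = fold (wedge_col q M) ?js unit_form"
  define F where "F k l = wedge_col q M l (wedge_col q M k \<omega>) {0..<n} * (N $$ (l,b) * N $$ (k,a))" for k l
  have vanish: "wedge_col q M k \<omega> = (\<lambda>T. 0)" if "k < n" "k \<noteq> i\<^sub>1" "k \<noteq> i\<^sub>2" for k
    unfolding \<omega>_def
    by (rule fold_wedge_col_repeated[OF assms(1,3)]) (use assms(2) that in \<open>auto simp: set_nths_upt\<close>)
  have dim: "i\<^sub>1 < dim_col M" "i\<^sub>2 < dim_col M" using assms by auto
  have swap: "wedge_col q M i\<^sub>1 (wedge_col q M i\<^sub>2 \<omega>) = (\<lambda>T. ?c *\<^sub>C wedge_col q M i\<^sub>2 (wedge_col q M i\<^sub>1 \<omega>) T)"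
    by (rule wedge_col_swap[OF assms(1,3,6) dim(2)])
  have F0: "F k l = 0" if "k < n" "l < n" "(k, l) \<noteq> (i\<^sub>1, i\<^sub>2)" "(k, l) \<noteq> (i\<^sub>2, i\<^sub>1)" for k l
  proof -
    have "k \<notin> {i\<^sub>1, i\<^sub>2} \<or> k = l \<or> (k \<in> {i\<^sub>1, i\<^sub>2} \<and> l \<notin> {i\<^sub>1, i\<^sub>2})"
      using that(3,4) by auto
    then consider "k \<notin> {i\<^sub>1, i\<^sub>2}" | "k = l" | "k \<in> {i\<^sub>1, i\<^sub>2}" "l \<notin> {i\<^sub>1, i\<^sub>2}"
      by blast
    then show ?thesis
    proof cases
      case 1
      then show ?thesis using vanish that by (simp add: F_def wedge_col_zero)
    next
      case 2
      then show ?thesis using wedge_col_same[OF assms(3)] that assms(2) by (simp add: F_def)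
    next
      case 3
      then have "wedge_col q M l (fold (wedge_col q M) (?js @ [k]) unit_form) = (\<lambda>T. 0)"
        by (intro fold_wedge_col_repeated[OF assms(1,3)]) (use assms(2) that in \<open>auto simp: set_nths_upt\<close>)
      then show ?thesis by (simp add: F_def \<omega>_def)
    qed
  qed
  have top: "wedge_col q M i\<^sub>2 (wedge_col q M i\<^sub>1 \<omega>) {0..<n} =
      ?c ^ (n - 2 - i\<^sub>1 + (n - 1 - i\<^sub>2)) *\<^sub>C q_det q M"
    unfolding \<omega>_def fold_wedge_col_two_removed[OF assms(1,2,3,6,7)]
    by (simp add: fold_wedge_col_all_eq_q_det[OF assms(2)])
  have exp: "2 * n - 2 - i\<^sub>1 - i\<^sub>2 = Suc (n - 2 - i\<^sub>1 + (n - 1 - i\<^sub>2))" using assms by simp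
  have "wedge q b (wedge q a \<omega>) {0..<n} = (\<Sum>k<n. wedge q b (wedge_col q M k \<omega>) {0..<n} * N $$ (k,a))"
    by (subst wedge_eq_sum_wedge_col[OF assms(2,4,5,8)]) (simp add: wedge_sum_mult)
  also have "\<dots> = (\<Sum>k<n. \<Sum>l<n. F k l)"
    by (subst wedge_eq_sum_wedge_col[OF assms(2,4,5,9)]) (simp add: F_def sum_distrib_right mult.assoc)
  also have "\<dots> = (\<Sum>(k, l)\<in>{..<n} \<times> {..<n}. F k l)" by (simp add: sum.cartesian_product)
  also have "\<dots> = (\<Sum>(k, l)\<in>{(i\<^sub>1, i\<^sub>2), (i\<^sub>2, i\<^sub>1)}. F k l)"
    by (rule sum.mono_neutral_right) (use F0 assms in auto)
  also have "\<dots> = F i\<^sub>1 i\<^sub>2 + F i\<^sub>2 i\<^sub>1" using assms by simp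
  also have "\<dots> = ?c ^ (n - 2 - i\<^sub>1 + (n - 1 - i\<^sub>2)) *\<^sub>C
      (q_det q M * (N $$ (i\<^sub>2,b) * N $$ (i\<^sub>1,a) + ?c *\<^sub>C (N $$ (i\<^sub>1,b) * N $$ (i\<^sub>2,a))))"
    unfolding F_def swap top
    by (simp only: mult_scaleC_left mult_scaleC_right distrib_left scaleC_add_right scaleC_scaleC mult.commute)
  also have "N $$ (i\<^sub>2,b) * N $$ (i\<^sub>1,a) + ?c *\<^sub>C (N $$ (i\<^sub>1,b) * N $$ (i\<^sub>2,a)) =
      ?c *\<^sub>C (N $$ (i\<^sub>1,b) * N $$ (i\<^sub>2,a) - q *\<^sub>C (N $$ (i\<^sub>2,b) * N $$ (i\<^sub>1,a)))"
    using assms(1) by (simp add: scaleC_diff_right scaleC_scaleC scaleC_minus_left scaleC_one)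
  finally show ?thesis
    unfolding \<omega>_def exp by (simp only: mult_scaleC_right scaleC_scaleC power_Suc mult.commute)
qed

text \<open>
  The generator multiplied last passes all larger elements of the full set. The one multiplied first
  does not see the other, which makes a difference only if it is the smaller one: this explains
  why the two exponents differ by one.
\<close>

lemma wedge_wedge_top:
  assumes "j\<^sub>1 < j\<^sub>2" "j\<^sub>2 < n"
  shows "wedge q j\<^sub>1 (wedge q j\<^sub>2 \<omega>) {0..<n} =
      (- inverse q) ^ (2 * n - 2 - j\<^sub>1 - j\<^sub>2) *\<^sub>C \<omega> {i. i < n \<and> i \<in> - {j\<^sub>1, j\<^sub>2}}"
    and "wedge q j\<^sub>2 (wedge q j\<^sub>1 \<omega>) {0..<n} =
      (- inverse q) ^ (2 * n - 3 - j\<^sub>1 - j\<^sub>2) *\<^sub>C \<omega> {i. i < n \<and> i \<in> - {j\<^sub>1, j\<^sub>2}}"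
proof -
  have sets: "{0..<n} - {j\<^sub>1} - {j\<^sub>2} = {i. i < n \<and> i \<in> - {j\<^sub>1, j\<^sub>2}}"
      "{0..<n} - {j\<^sub>2} - {j\<^sub>1} = {i. i < n \<and> i \<in> - {j\<^sub>1, j\<^sub>2}}"
    by auto
  have "{s\<in>{0..<n}. j < s} = {Suc j..<n}" for j by auto
  moreover have "{s\<in>{0..<n} - {j\<^sub>1}. j\<^sub>2 < s} = {s\<in>{0..<n}. j\<^sub>2 < s}" using assms(1) by auto
  moreover have "{s\<in>{0..<n} - {j\<^sub>2}. j\<^sub>1 < s} = {s\<in>{0..<n}. j\<^sub>1 < s} - {j\<^sub>2}" by auto
  ultimately have cards: "card {s\<in>{0..<n}. j\<^sub>1 < s} = n - Suc j\<^sub>1" "card {s\<in>{0..<n} - {j\<^sub>1}. j\<^sub>2 < s} = n - Suc j\<^sub>2"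
      "card {s\<in>{0..<n}. j\<^sub>2 < s} = n - Suc j\<^sub>2" "card {s\<in>{0..<n} - {j\<^sub>2}. j\<^sub>1 < s} = n - Suc j\<^sub>1 - 1"
    using assms by simp_all
  have exps: "2 * n - 2 - j\<^sub>1 - j\<^sub>2 = n - Suc j\<^sub>1 + (n - Suc j\<^sub>2)"
      "2 * n - 3 - j\<^sub>1 - j\<^sub>2 = n - Suc j\<^sub>2 + (n - Suc j\<^sub>1 - 1)"
    using assms by simp_all
  show "wedge q j\<^sub>1 (wedge q j\<^sub>2 \<omega>) {0..<n} =
      (- inverse q) ^ (2 * n - 2 - j\<^sub>1 - j\<^sub>2) *\<^sub>C \<omega> {i. i < n \<and> i \<in> - {j\<^sub>1, j\<^sub>2}}"
    unfolding exps power_add using assms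
    by (simp only: wedge_def cards sets scaleC_scaleC) (simp add: scaleC_scaleC)
  show "wedge q j\<^sub>2 (wedge q j\<^sub>1 \<omega>) {0..<n} =
      (- inverse q) ^ (2 * n - 3 - j\<^sub>1 - j\<^sub>2) *\<^sub>C \<omega> {i. i < n \<and> i \<in> - {j\<^sub>1, j\<^sub>2}}"
    unfolding exps power_add using assms
    by (simp only: wedge_def cards sets scaleC_scaleC) (simp add: scaleC_scaleC)
qed

lemma scaleC_power_inverse_eqD:
  assumes "q \<noteq> 0" "(- inverse q) ^ m *\<^sub>C y = (- inverse q) ^ k *\<^sub>C (x::'a::complex_algebra_1)"
  shows "x = (- q) powi (int k - int m) *\<^sub>C y"
proof (rule scaleC_left_cancel)
  show "(- inverse q) ^ k \<noteq> 0" using assms(1) by simp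
  have "(- inverse q) ^ k * (- q) powi (int k - int m) = (- inverse q) ^ m"
    using assms(1) by (simp add: power_int_diff field_simps power_mult_distrib[symmetric])
  then show "(- inverse q) ^ k *\<^sub>C x = (- inverse q) ^ k *\<^sub>C ((- q) powi (int k - int m) *\<^sub>C y)"
    using assms(2) by (simp add: scaleC_scaleC)
qed

section \<open>The quadratic relations for the inverse\<close>

text \<open>
  Appending the same generator twice gives zero, so the power of \<open>- inverse q\<close> in
  \<open>wedge_wedge_two_removed\<close> can be cancelled.
\<close>

lemma q_det_mult_inverse_same_column:
  assumes "q \<noteq> 0" "M \<in> carrier_mat n n" "q_manin q M" "N \<in> carrier_mat n n" "M * N = 1\<^sub>m n"
    and "i\<^sub>1 < i\<^sub>2" "i\<^sub>2 < n" "j < n"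
  shows "q_det q M * (N $$ (i\<^sub>1,j) * N $$ (i\<^sub>2,j) - q *\<^sub>C (N $$ (i\<^sub>2,j) * N $$ (i\<^sub>1,j))) = 0"
    (is "?D = 0")
proof (rule scaleC_left_cancel)
  show "(- inverse q) ^ (2 * n - 2 - i\<^sub>1 - i\<^sub>2) \<noteq> 0" using assms(1) by simp
  show "(- inverse q) ^ (2 * n - 2 - i\<^sub>1 - i\<^sub>2) *\<^sub>C ?D = (- inverse q) ^ (2 * n - 2 - i\<^sub>1 - i\<^sub>2) *\<^sub>C 0"
    using wedge_wedge_two_removed[OF assms assms(8)] by (simp add: wedge_wedge_same scaleC_zero_right)
qed

lemma fold_wedge_col_complement_minor:
  assumes "M \<in> carrier_mat n n" "i\<^sub>1 < i\<^sub>2" "i\<^sub>2 < n" "j\<^sub>1 < j\<^sub>2" "j\<^sub>2 < n"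
  shows "fold (wedge_col q M) (nths [0..<n] (- {i\<^sub>1, i\<^sub>2})) unit_form {i. i < n \<and> i \<in> - {j\<^sub>1, j\<^sub>2}} =
    q_det q (submatrix M (- {j\<^sub>1, j\<^sub>2}) (- {i\<^sub>1, i\<^sub>2}))"
proof -
  have "card {i. i < n \<and> i \<in> - {a, b}} = n - 2" if "a < b" "b < n" for a b
  proof -
    have "{i. i < n \<and> i \<in> - {a, b}} = {..<n} - {a, b}" by auto
    then show ?thesis using that by (simp add: card_Diff_subset)
  qed
  then show ?thesis
    using fold_wedge_col_nths_eq_q_det_submatrix[of M "- {j\<^sub>1, j\<^sub>2}" "- {i\<^sub>1, i\<^sub>2}" q] assms
    by simp
qed

text \<open>
  Appending first the larger generator \<open>\<psi>\<close> of index \<open>j\<^sub>2\<close> and then the one of index \<open>j\<^sub>1\<close> produces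
  the bracket with the columns \<open>j\<^sub>1, j\<^sub>2\<close> of \<open>N\<close> in increasing order; the other order of appending
  produces the reversed bracket. Both times the coefficient is the same minor of \<open>M\<close>, up to
  the powers of \<open>- inverse q\<close> from the two computations, whose quotient is the power of \<open>- q\<close>.
\<close>

lemma q_det_mult_inverse_columns_in_order:
  assumes "q \<noteq> 0" "M \<in> carrier_mat n n" "q_manin q M" "N \<in> carrier_mat n n" "M * N = 1\<^sub>m n"
    and "i\<^sub>1 < i\<^sub>2" "i\<^sub>2 < n" "j\<^sub>1 < j\<^sub>2" "j\<^sub>2 < n"
  shows "q_det q M * (N $$ (i\<^sub>1,j\<^sub>1) * N $$ (i\<^sub>2,j\<^sub>2) - q *\<^sub>C (N $$ (i\<^sub>2,j\<^sub>1) * N $$ (i\<^sub>1,j\<^sub>2))) =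
    (- q) powi (int j\<^sub>1 + int j\<^sub>2 - int i\<^sub>1 - int i\<^sub>2) *\<^sub>C
      q_det q (submatrix M (- {j\<^sub>1, j\<^sub>2}) (- {i\<^sub>1, i\<^sub>2}))"
proof -
  let ?\<omega> = "fold (wedge_col q M) (nths [0..<n] (- {i\<^sub>1, i\<^sub>2})) unit_form"
  have "j\<^sub>1 < n" using assms(8,9) by simp
  have exp: "int j\<^sub>1 + int j\<^sub>2 - int i\<^sub>1 - int i\<^sub>2 =
      int (2 * n - 2 - i\<^sub>1 - i\<^sub>2) - int (2 * n - 2 - j\<^sub>1 - j\<^sub>2)"
    using assms(6-9) by (simp add: of_nat_diff)
  show ?thesis
    unfolding exp
  proof (rule scaleC_power_inverse_eqD[OF assms(1)])
    show "(- inverse q) ^ (2 * n - 2 - j\<^sub>1 - j\<^sub>2) *\<^sub>C q_det q (submatrix M (- {j\<^sub>1, j\<^sub>2}) (- {i\<^sub>1, i\<^sub>2})) =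
        (- inverse q) ^ (2 * n - 2 - i\<^sub>1 - i\<^sub>2) *\<^sub>C
          (q_det q M * (N $$ (i\<^sub>1,j\<^sub>1) * N $$ (i\<^sub>2,j\<^sub>2) - q *\<^sub>C (N $$ (i\<^sub>2,j\<^sub>1) * N $$ (i\<^sub>1,j\<^sub>2))))"
      using wedge_wedge_two_removed[OF assms(1-7) assms(9) \<open>j\<^sub>1 < n\<close>]
        wedge_wedge_top(1)[OF assms(8,9), of q ?\<omega>] fold_wedge_col_complement_minor[OF assms(2,6-9), of q]
      by simp
  qed
qed

lemma q_det_mult_inverse_columns_reversed:
  assumes "q \<noteq> 0" "M \<in> carrier_mat n n" "q_manin q M" "N \<in> carrier_mat n n" "M * N = 1\<^sub>m n"
    and "i\<^sub>1 < i\<^sub>2" "i\<^sub>2 < n" "j\<^sub>1 < j\<^sub>2" "j\<^sub>2 < n"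
  shows "q_det q M * (N $$ (i\<^sub>1,j\<^sub>2) * N $$ (i\<^sub>2,j\<^sub>1) - q *\<^sub>C (N $$ (i\<^sub>2,j\<^sub>2) * N $$ (i\<^sub>1,j\<^sub>1))) =
    (- q) powi (int j\<^sub>1 + int j\<^sub>2 - int i\<^sub>1 - int i\<^sub>2 + 1) *\<^sub>C
      q_det q (submatrix M (- {j\<^sub>1, j\<^sub>2}) (- {i\<^sub>1, i\<^sub>2}))"
proof -
  let ?\<omega> = "fold (wedge_col q M) (nths [0..<n] (- {i\<^sub>1, i\<^sub>2})) unit_form"
  have "j\<^sub>1 < n" using assms(8,9) by simp
  have exp: "int j\<^sub>1 + int j\<^sub>2 - int i\<^sub>1 - int i\<^sub>2 + 1 =
      int (2 * n - 2 - i\<^sub>1 - i\<^sub>2) - int (2 * n - 3 - j\<^sub>1 - j\<^sub>2)"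
    using assms(6-9) by (simp add: of_nat_diff)
  show ?thesis
    unfolding exp
  proof (rule scaleC_power_inverse_eqD[OF assms(1)])
    show "(- inverse q) ^ (2 * n - 3 - j\<^sub>1 - j\<^sub>2) *\<^sub>C q_det q (submatrix M (- {j\<^sub>1, j\<^sub>2}) (- {i\<^sub>1, i\<^sub>2})) =
        (- inverse q) ^ (2 * n - 2 - i\<^sub>1 - i\<^sub>2) *\<^sub>C
          (q_det q M * (N $$ (i\<^sub>1,j\<^sub>2) * N $$ (i\<^sub>2,j\<^sub>1) - q *\<^sub>C (N $$ (i\<^sub>2,j\<^sub>2) * N $$ (i\<^sub>1,j\<^sub>1))))"
      using wedge_wedge_two_removed[OF assms(1-7) \<open>j\<^sub>1 < n\<close> assms(9)]
        wedge_wedge_top(2)[OF assms(8,9), of q ?\<omega>] fold_wedge_col_complement_minor[OF assms(2,6-9), of q]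
      by simp
  qed
qed

theorem proposition4p6:
  fixes q :: complex
    and n :: nat
    and M N :: "'a::complex_algebra_1 mat"
    and i\<^sub>1 i\<^sub>2 j j\<^sub>1 j\<^sub>2 :: nat
  assumes "q \<noteq> 0"
    and "M \<in> carrier_mat n n"
    and "q_manin q M"
    and "N \<in> carrier_mat n n"
    and "N * M = 1\<^sub>m n"
    and "M * N = 1\<^sub>m n"
    and "i\<^sub>1 < i\<^sub>2" and "i\<^sub>2 < n"
    and "j < n"
    and "j\<^sub>1 < j\<^sub>2" and "j\<^sub>2 < n"
  shows "q_det q M * (N $$ (i\<^sub>1,j) * N $$ (i\<^sub>2,j) - q *\<^sub>C (N $$ (i\<^sub>2,j) * N $$ (i\<^sub>1,j))) = 0
      \<and> q_det q M * (N $$ (i\<^sub>1,j\<^sub>1) * N $$ (i\<^sub>2,j\<^sub>2) - q *\<^sub>C (N $$ (i\<^sub>2,j\<^sub>1) * N $$ (i\<^sub>1,j\<^sub>2))) =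
      (- q) powi (int j\<^sub>1 + int j\<^sub>2 - int i\<^sub>1 - int i\<^sub>2) *\<^sub>C
        q_det q (submatrix M (- {j\<^sub>1, j\<^sub>2}) (- {i\<^sub>1, i\<^sub>2}))
      \<and> q_det q M * (N $$ (i\<^sub>1,j\<^sub>2) * N $$ (i\<^sub>2,j\<^sub>1) - q *\<^sub>C (N $$ (i\<^sub>2,j\<^sub>2) * N $$ (i\<^sub>1,j\<^sub>1))) =
      (- q) powi (int j\<^sub>1 + int j\<^sub>2 - int i\<^sub>1 - int i\<^sub>2 + 1) *\<^sub>C
        q_det q (submatrix M (- {j\<^sub>1, j\<^sub>2}) (- {i\<^sub>1, i\<^sub>2}))"
proof (intro conjI)
  show "q_det q M * (N $$ (i\<^sub>1,j) * N $$ (i\<^sub>2,j) - q *\<^sub>C (N $$ (i\<^sub>2,j) * N $$ (i\<^sub>1,j))) = 0"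
    by (rule q_det_mult_inverse_same_column[OF assms(1-4,6-9)])
  show "q_det q M * (N $$ (i\<^sub>1,j\<^sub>1) * N $$ (i\<^sub>2,j\<^sub>2) - q *\<^sub>C (N $$ (i\<^sub>2,j\<^sub>1) * N $$ (i\<^sub>1,j\<^sub>2))) =
      (- q) powi (int j\<^sub>1 + int j\<^sub>2 - int i\<^sub>1 - int i\<^sub>2) *\<^sub>C
        q_det q (submatrix M (- {j\<^sub>1, j\<^sub>2}) (- {i\<^sub>1, i\<^sub>2}))"
    by (rule q_det_mult_inverse_columns_in_order[OF assms(1-4,6-8,10,11)])
  show "q_det q M * (N $$ (i\<^sub>1,j\<^sub>2) * N $$ (i\<^sub>2,j\<^sub>1) - q *\<^sub>C (N $$ (i\<^sub>2,j\<^sub>2) * N $$ (i\<^sub>1,j\<^sub>1))) =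
      (- q) powi (int j\<^sub>1 + int j\<^sub>2 - int i\<^sub>1 - int i\<^sub>2 + 1) *\<^sub>C
        q_det q (submatrix M (- {j\<^sub>1, j\<^sub>2}) (- {i\<^sub>1, i\<^sub>2}))"
    by (rule q_det_mult_inverse_columns_reversed[OF assms(1-4,6-8,10,11)])
qed

end
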